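(* Consider a connected power network with nodes $i=1,\dots,I$, demands $D_i\ge0$, and generators $n=1,\dots,N$ with cost functions $c_n$. Assume: (1) the feasible dispatch set remains non-empty if any one of the generators is excluded, i.e. for each generator $n_0$ there is a feasible point of the economic dispatch problem with $x_{n_0}=0$; (2) (congestion-free condition) no line flow constraint is binding in the economic dispatch problem, i.e. $Y_{ij}(\theta_i-\theta_j)<C_{ij}$ for all $(i,j)$ joined by a line at its optimal solution. Then there exists an efficient Nash equilibrium in the LMP game.
   Context: Network: a connected power network with nodes $i=1,\dots,I$; line $i$-$j$ has admittance $Y_{ij}=Y_{ji}>0$ ($Y_{ij}=0$ if there is no line) and capacity $C_{ij}=C_{ji}>0$. There are generators $n=1,\dots,N$; $\mathcal N_i$ is the set of generators at node $i$; generator $n$ has cost function $c_n:\mathbb R_+\to\mathbb R_+$ with $c_n(0)=0$, $c_n'\ge 0$, $c_n''\ge 0$. Node $i$ has inelastic demand $D_i\ge 0$. Economic dispatch problem: minimize $\sum_n c_n(x_n)$ over $x_n,\theta_i\in\mathbb R$ subject to $\sum_{n\in\mathcal N_i}x_n-D_i=\sum_jY_{ij}(\theta_i-\theta_j)$ for all $i$ (power balance); $Y_{ij}(\theta_i-\theta_j)\le C_{ij}$ for all ordered pairs $(i,j)$ joined by a line (line flow); $x_n\ge0$ for all $n$. LMP game. Each generator $n$ submits a bid $(p_n,s_n,q_n)$ with $0\le p_n\le q_n$, $s_n\ge0$, identified with the function $b_n(x_n)=p_nx_n$ for $x_n\le s_n$ and $b_n(x_n)=q_nx_n+(p_n-q_n)s_n$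 for $x_n>s_n$. Given the bid profile $b=(b_1,\dots,b_N)$, the dispatch $x$ is (the $x$-part of) an optimal solution $(x,\theta)$ of the economic dispatch problem with each $c_n$ replaced by $b_n$. The locational marginal prices (LMPs) $\pi=(\pi_1,\dots,\pi_I)$ are the optimal Lagrange multipliers of the power balance equalities in that problem: there are multipliers $\mu_{ij}\ge0$ for the line constraints such that for $n\in\mathcal N_i$: $\pi_i$ lies between the left and right derivatives of $b_n$ at $x_n$ if $x_n>0$, and $\pi_i$ is at most the right derivative of $b_n$ at $0$ if $x_n=0$; $\sum_jY_{ij}(\pi_i-\pi_j+\mu_{ij}-\mu_{ji})=0$ for all $i$; and $\mu_{ij}[Y_{ij}(\theta_i-\theta_j)-C_{ij}]=0$ for all $(i,j)$. If the optimal $\pi$ is not unique, ties are broken by choosing the lexicographically smallest one (first minimize $\pi_1$, then $\pi_2$, and so on). If the optimal $x$ is not unique, any optimal $x$ may be the dispatch associated with $b$. The pair $(x,\pi)$ is an outcome associated with $b$. The payoff of generator $n\in\mathcal N_i$ is $u_n=\pi_ix_n-c_n(x_n)$. A (pure) Nash equilibrium is a bid profile $b$ together with an associated outcome $(x,\pi)$ such that no generator can be strictly better off by a unilateral change of his bid (for no generator $n$ and no alternative bid of $n$ does an outcome associated with the changed profile give $n$ a strictly larger payoff). It is efficient if $x$ also solves the economic dispatch problem (with the true costs $c_n$).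
   Formalization: If all demands D_i are zero, the optimal prices are unbounded below and no lexicographically smallest one exists, so literally no outcome exists; in that case every optimal π is admitted as the LMP vector. *)

theory Defs
  imports "HOL-Analysis.Analysis" "HOL-Library.Fun_Lexorder"
begin

text \<open>
  Nodes are the elements of a finite linearly ordered type (the order matters only for the
  lexicographic tie-breaking of prices), generators those of a finite type. A zero
  admittance encodes the absence of a line; the capacity is then irrelevant.
\<close>

record ('i, 'n) power_network =
  admittance :: "'i \<Rightarrow> 'i \<Rightarrow> real"
  capacity :: "'i \<Rightarrow> 'i \<Rightarrow> real"
  demand :: "'i \<Rightarrow> real"
  node_of :: "'n \<Rightarrow> 'i"

definition is_line :: "('i, 'n) power_network \<Rightarrow> 'i \<Rightarrow> 'i \<Rightarrow> bool" where
  "is_line G i j \<longleftrightarrow> admittance G i j > 0"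

definition connected_power_network :: "('i::{finite,linorder}, 'n::finite) power_network \<Rightarrow> bool" where
  "connected_power_network G \<longleftrightarrow>
     (\<forall>i j. admittance G i j \<ge> 0 \<and> admittance G i j = admittance G j i) \<and>
     (\<forall>i j. is_line G i j \<longrightarrow> capacity G i j > 0 \<and> capacity G i j = capacity G j i) \<and>
     (\<forall>i. demand G i \<ge> 0) \<and>
     (\<forall>i j. (is_line G)\<^sup>*\<^sup>* i j)"

definition cost_function :: "(real \<Rightarrow> real) \<Rightarrow> bool" where
  "cost_function f \<longleftrightarrow>
     f 0 = 0 \<and> (\<forall>x\<ge>0. f x \<ge> 0) \<and>
     (\<exists>f' f''. \<forall>x\<ge>0.
        (f has_real_derivative f' x) (at x within {0..}) \<and>
        (f' has_real_derivative f'' x) (at x within {0..}) \<and>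
        f' x \<ge> 0 \<and> f'' x \<ge> 0)"

definition flow :: "('i, 'n) power_network \<Rightarrow> ('i \<Rightarrow> real) \<Rightarrow> 'i \<Rightarrow> 'i \<Rightarrow> real" where
  "flow G \<theta> i j = admittance G i j * (\<theta> i - \<theta> j)"

definition ed_feasible ::
  "('i::{finite,linorder}, 'n::finite) power_network \<Rightarrow> ('n \<Rightarrow> real) \<Rightarrow> ('i \<Rightarrow> real) \<Rightarrow> bool" where
  "ed_feasible G x \<theta> \<longleftrightarrow>
     (\<forall>i. (\<Sum>n | node_of G n = i. x n) - demand G i = (\<Sum>j\<in>UNIV. flow G \<theta> i j)) \<and>
     (\<forall>i j. is_line G i j \<longrightarrow> flow G \<theta> i j \<le> capacity G i j) \<and>
     (\<forall>n. x n \<ge> 0)"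

text \<open>The objective \<open>f\<close> is the profile of true costs or the profile of bids.\<close>

definition ed_optimal ::
  "('i::{finite,linorder}, 'n::finite) power_network \<Rightarrow> ('n \<Rightarrow> real \<Rightarrow> real) \<Rightarrow>
   ('n \<Rightarrow> real) \<Rightarrow> ('i \<Rightarrow> real) \<Rightarrow> bool" where
  "ed_optimal G f x \<theta> \<longleftrightarrow>
     ed_feasible G x \<theta> \<and>
     (\<forall>x' \<theta>'. ed_feasible G x' \<theta>' \<longrightarrow> (\<Sum>n\<in>UNIV. f n (x n)) \<le> (\<Sum>n\<in>UNIV. f n (x' n)))"

type_synonym bid = "real \<times> real \<times> real"

fun valid_bid :: "bid \<Rightarrow> bool" where
  "valid_bid (p, s, q) \<longleftrightarrow> 0 \<le> p \<and> p \<le> q \<and> 0 \<le> s"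

fun bid_fun :: "bid \<Rightarrow> real \<Rightarrow> real" where
  "bid_fun (p, s, q) x = (if x \<le> s then p * x else q * x + (p - q) * s)"

definition optimal_multipliers ::
  "('i::{finite,linorder}, 'n::finite) power_network \<Rightarrow> ('n \<Rightarrow> real \<Rightarrow> real) \<Rightarrow>
   ('n \<Rightarrow> real) \<Rightarrow> ('i \<Rightarrow> real) \<Rightarrow> ('i \<Rightarrow> real) set" where
  "optimal_multipliers G f x \<theta> = {\<pi>. \<exists>\<mu>.
     (\<forall>i j. \<mu> i j \<ge> 0) \<and>
     (\<forall>n. x n > 0 \<longrightarrow> (\<exists>l r.
        (f n has_real_derivative l) (at_left (x n)) \<and>
        (f n has_real_derivative r) (at_right (x n)) \<and>
        l \<le> \<pi> (node_of G n) \<and> \<pi> (node_of G n) \<le> r)) \<and>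
     (\<forall>n. x n = 0 \<longrightarrow> (\<exists>r.
        (f n has_real_derivative r) (at_right 0) \<and> \<pi> (node_of G n) \<le> r)) \<and>
     (\<forall>i. (\<Sum>j\<in>UNIV. admittance G i j * (\<pi> i - \<pi> j + \<mu> i j - \<mu> j i)) = 0) \<and>
     (\<forall>i j. is_line G i j \<longrightarrow> \<mu> i j * (flow G \<theta> i j - capacity G i j) = 0)}"

definition lex_smallest :: "('i::{finite,linorder} \<Rightarrow> real) set \<Rightarrow> ('i \<Rightarrow> real) \<Rightarrow> bool" where
  "lex_smallest S \<pi> \<longleftrightarrow> \<pi> \<in> S \<and> (\<forall>\<pi>'\<in>S. \<pi>' \<noteq> \<pi> \<longrightarrow> less_fun \<pi> \<pi>')"

text \<open>
  The set of optimal multipliers can be unbounded below, and then it need not have a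
  lexicographically smallest element: if all demands vanish, every dispatch is zero and
  arbitrarily negative uniform prices are optimal multipliers. In that case the tie-breaking
  rule selects nothing, and every optimal multiplier is admitted as a price vector.
\<close>

definition is_lmp ::
  "('i::{finite,linorder}, 'n::finite) power_network \<Rightarrow> ('n \<Rightarrow> real \<Rightarrow> real) \<Rightarrow>
   ('n \<Rightarrow> real) \<Rightarrow> ('i \<Rightarrow> real) \<Rightarrow> ('i \<Rightarrow> real) \<Rightarrow> bool" where
  "is_lmp G f x \<theta> \<pi> \<longleftrightarrow>
     \<pi> \<in> optimal_multipliers G f x \<theta> \<and>
     ((\<exists>\<pi>'. lex_smallest (optimal_multipliers G f x \<theta>) \<pi>') \<longrightarrow>
        lex_smallest (optimal_multipliers G f x \<theta>) \<pi>)"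

definition outcome ::
  "('i::{finite,linorder}, 'n::finite) power_network \<Rightarrow> ('n \<Rightarrow> bid) \<Rightarrow>
   ('n \<Rightarrow> real) \<Rightarrow> ('i \<Rightarrow> real) \<Rightarrow> bool" where
  "outcome G b x \<pi> \<longleftrightarrow>
     (\<exists>\<theta>. ed_optimal G (\<lambda>n. bid_fun (b n)) x \<theta> \<and> is_lmp G (\<lambda>n. bid_fun (b n)) x \<theta> \<pi>)"

definition payoff ::
  "('i, 'n) power_network \<Rightarrow> ('n \<Rightarrow> real \<Rightarrow> real) \<Rightarrow> 'n \<Rightarrow> ('n \<Rightarrow> real) \<Rightarrow> ('i \<Rightarrow> real) \<Rightarrow> real" where
  "payoff G c n x \<pi> = \<pi> (node_of G n) * x n - c n (x n)"

text \<open>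
  An outcome need not be unique for a given profile, so the outcome is part of the equilibrium,
  and a deviation must not be profitable for any of the outcomes it may lead to.
\<close>

definition nash_equilibrium ::
  "('i::{finite,linorder}, 'n::finite) power_network \<Rightarrow> ('n \<Rightarrow> real \<Rightarrow> real) \<Rightarrow>
   ('n \<Rightarrow> bid) \<Rightarrow> ('n \<Rightarrow> real) \<Rightarrow> ('i \<Rightarrow> real) \<Rightarrow> bool" where
  "nash_equilibrium G c b x \<pi> \<longleftrightarrow>
     (\<forall>n. valid_bid (b n)) \<and> outcome G b x \<pi> \<and>
     (\<forall>n \<beta> x' \<pi>'. valid_bid \<beta> \<and> outcome G (b(n := \<beta>)) x' \<pi>' \<longrightarrow>
        payoff G c n x' \<pi>' \<le> payoff G c n x \<pi>)"

definition efficient ::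
  "('i::{finite,linorder}, 'n::finite) power_network \<Rightarrow> ('n \<Rightarrow> real \<Rightarrow> real) \<Rightarrow> ('n \<Rightarrow> real) \<Rightarrow> bool" where
  "efficient G c x \<longleftrightarrow> (\<exists>\<theta>. ed_optimal G c x \<theta>)"

end

theory Submission
  imports Defs
begin

text \<open>
  Let every generator bid the constant price \<open>\<rho>\<close> equal to the common marginal cost at the
  efficient dispatch. Without congestion the multipliers are uniform, equal to \<open>\<rho>\<close> as soon as
  something is produced, and the efficient dispatch maximizes every generator's profit at the
  price \<open>\<rho>\<close>. Suppose a deviating generator is dispatched at a positive level. The remaining
  generators can serve the demand without it, and they all bid \<open>\<rho>\<close>, so the multiplier
  conditions force the price at its node to be at most \<open>\<rho>\<close>. Hence no deviation is profitable.
\<close>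

section \<open>Potential flows\<close>

text \<open>The weighted graph Laplacian of the network, with the admittances as edge weights,
  applied to the potential \<open>\<theta>\<close>.\<close>

definition net_outflow :: "('i, 'n) power_network \<Rightarrow> ('i::finite \<Rightarrow> real) \<Rightarrow> 'i \<Rightarrow> real" where
  "net_outflow G \<theta> i = (\<Sum>j\<in>UNIV. flow G \<theta> i j)"

lemma flow_add: "flow G (\<lambda>i. \<theta> i + e * \<delta> i) i j = flow G \<theta> i j + e * flow G \<delta> i j"
  by (simp add: flow_def algebra_simps)

lemma net_outflow_add:
  "net_outflow G (\<lambda>i. \<theta> i + e * \<delta> i) i = net_outflow G \<theta> i + e * net_outflow G \<delta> i"
  by (simp add: net_outflow_def flow_add sum.distrib sum_distrib_left)

text \<open>Summation by parts: exchanging the indices turns \<open>a i * f i j\<close> into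
  \<open>- a j * f i j\<close>, and adding both forms of the sum gives the factor 2.\<close>

lemma sum_weighted_antisym:
  fixes a :: "'i::finite \<Rightarrow> real"
  assumes "\<And>i j. f i j = - f j i"
  shows "2 * (\<Sum>i\<in>UNIV. a i * (\<Sum>j\<in>UNIV. f i j)) = (\<Sum>i\<in>UNIV. \<Sum>j\<in>UNIV. (a i - a j) * f i j)"
proof -
  have "(\<Sum>i\<in>UNIV. a i * (\<Sum>j\<in>UNIV. f i j)) = (\<Sum>i\<in>UNIV. \<Sum>j\<in>UNIV. a i * f i j)"
    by (simp add: sum_distrib_left)
  moreover have "(\<Sum>i\<in>UNIV. \<Sum>j\<in>UNIV. a i * f i j) = (\<Sum>i\<in>UNIV. \<Sum>j\<in>UNIV. a j * f j i)"
    by (rule sum.swap)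
  moreover have "(\<Sum>i\<in>UNIV. \<Sum>j\<in>UNIV. a j * f j i) = - (\<Sum>i\<in>UNIV. \<Sum>j\<in>UNIV. a j * f i j)"
    by (subst assms) (simp add: sum_negf)
  ultimately show ?thesis
    by (simp add: sum_subtractf left_diff_distrib)
qed

context
  fixes G :: "('i::{finite,linorder}, 'n::finite) power_network"
  assumes conn: "connected_power_network G"
begin

lemma flow_antisym: "flow G \<theta> i j = - flow G \<theta> j i"
  using conn unfolding connected_power_network_def flow_def
  by (metis minus_diff_eq mult_minus_right)

lemma sum_weighted_net_outflow:
  "2 * (\<Sum>i\<in>UNIV. a i * net_outflow G \<theta> i) = (\<Sum>i\<in>UNIV. \<Sum>j\<in>UNIV. (a i - a j) * flow G \<theta> i j)"
  unfolding net_outflow_def by (rule sum_weighted_antisym) (rule flow_antisym)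

lemma sum_net_outflow: "(\<Sum>i\<in>UNIV. net_outflow G \<theta> i) = 0"
  using sum_weighted_net_outflow[of "\<lambda>_. 1" \<theta>] by simp

text \<open>Both sums are half of one bilinear form in the potential differences, since a flow is a
  symmetric weight times a difference.\<close>

lemma net_outflow_self_adjoint:
  "(\<Sum>i\<in>UNIV. a i * net_outflow G \<theta> i) = (\<Sum>i\<in>UNIV. \<theta> i * net_outflow G a i)"
proof -
  have "(a i - a j) * flow G \<theta> i j = (\<theta> i - \<theta> j) * flow G a i j" for i j
    by (simp add: flow_def)
  then show ?thesis
    using sum_weighted_net_outflow[of a \<theta>] sum_weighted_net_outflow[of \<theta> a] by simp
qed

text \<open>The Dirichlet energy of \<open>\<theta>\<close> vanishes and is a sum of nonnegative
  terms, so \<open>\<theta>\<close> agrees at both ends of each line; connectedness spreads this to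
  all nodes.\<close>

lemma harmonic_imp_constant:
  assumes "\<And>i. net_outflow G \<theta> i = 0"
  shows "\<theta> i = \<theta> j"
proof -
  have nonneg: "(\<theta> i - \<theta> j) * flow G \<theta> i j \<ge> 0" for i j
  proof -
    have "(\<theta> i - \<theta> j) * flow G \<theta> i j = admittance G i j * (\<theta> i - \<theta> j)\<^sup>2"
      by (simp add: flow_def power2_eq_square)
    then show ?thesis
      using conn by (simp add: connected_power_network_def)
  qed
  have "(\<Sum>i\<in>UNIV. \<Sum>j\<in>UNIV. (\<theta> i - \<theta> j) * flow G \<theta> i j) = 0"
    using sum_weighted_net_outflow[of \<theta> \<theta>] assms by simp
  then have zero: "(\<theta> i - \<theta> j) * flow G \<theta> i j = 0" for i j
    using nonneg by (simp add: sum_nonneg_eq_0_iff sum_nonneg)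
  have line: "\<theta> i = \<theta> j" if "is_line G i j" for i j
    using zero[of i j] that by (auto simp: flow_def is_line_def)
  have "(is_line G)\<^sup>*\<^sup>* i j"
    using conn by (simp add: connected_power_network_def)
  then show ?thesis
    by induction (auto dest: line)
qed

text \<open>
  Adding the sum of all entries makes the Laplacian of a connected network injective, hence
  surjective; the added term vanishes on potentials whose image has zero sum.
\<close>

lemma net_outflow_surj:
  assumes "(\<Sum>i\<in>UNIV. v i) = 0"
  shows "\<exists>\<delta>. \<forall>i. net_outflow G \<delta> i = v i"
proof -
  define F :: "(real, 'i) vec \<Rightarrow> (real, 'i) vec" where
    "F t = (\<chi> i. net_outflow G (($) t) i + (\<Sum>j\<in>UNIV. t $ j))" for t
  have lin: "linear F"
    by (rule linearI) (simp_all add: F_def vec_eq_iff net_outflow_def flow_def sum.distrib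
        sum_distrib_left sum_subtractf algebra_simps)
  \<comment> \<open>The Laplacian part cancels in the total, so the entry sum of \<open>t\<close>
    can be read off from \<open>F t\<close>. This serves for injectivity and again for dropping the
    added term.\<close>
  have total: "(\<Sum>i\<in>UNIV. F t $ i) = of_nat CARD('i) * (\<Sum>j\<in>UNIV. t $ j)" for t
    by (simp add: F_def sum.distrib sum_net_outflow)
  have "inj F"
  proof (unfold linear_injective_0[OF lin], intro allI impI)
    fix t assume t: "F t = 0"
    with total[of t] have s: "(\<Sum>j\<in>UNIV. t $ j) = 0"
      by simp
    with t have "net_outflow G (($) t) i = 0" for i
      by (simp add: F_def vec_eq_iff)
    then have const: "t $ i = t $ j" for i j
      by (rule harmonic_imp_constant)
    show "t = 0"
      unfolding vec_eq_iff
    proof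
      fix i
      have "(\<Sum>j\<in>UNIV. t $ j) = of_nat CARD('i) * t $ i"
        using sum.cong[OF refl const[of _ i], where A = UNIV] by simp
      with s show "t $ i = 0 $ i"
        by simp
    qed
  qed
  then have "surj F"
    by (rule linear_inj_imp_surj[OF lin])
  then obtain t where t: "F t = (\<chi> i. v i)"
    by (metis surjD)
  with total[of t] assms have "(\<Sum>j\<in>UNIV. t $ j) = 0"
    by simp
  with t have "\<forall>i. net_outflow G (($) t) i = v i"
    by (simp add: F_def vec_eq_iff)
  then show ?thesis
    by blast
qed

section \<open>Feasible dispatches and multipliers\<close>

lemma feasible_balance:
  assumes "ed_feasible G x \<theta>"
  shows "(\<Sum>n | node_of G n = i. x n) = demand G i + net_outflow G \<theta> i"
  using assms by (simp add: ed_feasible_def net_outflow_def algebra_simps)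

text \<open>Generators are grouped by node and the power balance is inserted. Weights 1 give total
  production, prices as weights its market value.\<close>

lemma sum_weighted_feasible:
  assumes "ed_feasible G x \<theta>"
  shows "(\<Sum>n\<in>UNIV. a (node_of G n) * x n)
    = (\<Sum>i\<in>UNIV. a i * demand G i) + (\<Sum>i\<in>UNIV. a i * net_outflow G \<theta> i)"
proof -
  have "(\<Sum>n\<in>UNIV. a (node_of G n) * x n)
      = (\<Sum>i\<in>UNIV. \<Sum>n | node_of G n = i. a (node_of G n) * x n)"
    using sum.group[of "UNIV :: 'n set" "UNIV :: 'i set" "node_of G"
      "\<lambda>n. a (node_of G n) * x n"] by simp
  also have "\<dots> = (\<Sum>i\<in>UNIV. a i * (\<Sum>n | node_of G n = i. x n))"
    by (intro sum.cong refl) (simp add: sum_distrib_left)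
  also have "\<dots> = (\<Sum>i\<in>UNIV. a i * (demand G i + net_outflow G \<theta> i))"
    by (simp only: feasible_balance[OF assms])
  finally show ?thesis
    by (simp add: algebra_simps sum.distrib)
qed

lemma feasible_total:
  assumes "ed_feasible G x \<theta>"
  shows "(\<Sum>n\<in>UNIV. x n) = (\<Sum>i\<in>UNIV. demand G i)"
  using sum_weighted_feasible[OF assms, of "\<lambda>_. 1"] by (simp add: sum_net_outflow)

text \<open>The change in value pairs \<open>\<pi>\<close> with the Laplacian of the change in
  angles. Self-adjointness moves the Laplacian onto \<open>\<pi>\<close>, where stationarity
  expresses it by the line multipliers, and complementary slackness fixes the sign. So
  \<open>x\<close> is a cheapest feasible dispatch at the prices \<open>\<pi>\<close>.\<close>

lemma multiplier_variational:
  assumes x: "ed_feasible G x \<theta>" and y: "ed_feasible G y \<theta>'"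
    and \<pi>: "\<pi> \<in> optimal_multipliers G f x \<theta>"
  shows "(\<Sum>n\<in>UNIV. \<pi> (node_of G n) * (y n - x n)) \<ge> 0"
proof -
  from \<pi> obtain \<mu> where \<mu>0: "\<And>i j. \<mu> i j \<ge> 0"
    and stat: "\<And>i. (\<Sum>j\<in>UNIV. admittance G i j * (\<pi> i - \<pi> j + \<mu> i j - \<mu> j i)) = 0"
    and slack: "\<And>i j. is_line G i j \<Longrightarrow> \<mu> i j * (flow G \<theta> i j - capacity G i j) = 0"
    unfolding optimal_multipliers_def by blast
  have sym: "admittance G i j = admittance G j i" for i j
    using conn by (simp add: connected_power_network_def)
  define \<delta> where "\<delta> i = \<theta>' i - \<theta> i" for i
  define g where "g i j = admittance G i j * (\<mu> i j - \<mu> j i)" for i j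
  have \<pi>_out: "net_outflow G \<pi> i = - (\<Sum>j\<in>UNIV. g i j)" for i
  proof -
    have "net_outflow G \<pi> i + (\<Sum>j\<in>UNIV. g i j) = 0"
      unfolding stat[of i, symmetric] net_outflow_def g_def flow_def sum.distrib[symmetric]
      by (rule sum.cong) (simp_all add: algebra_simps)
    then show ?thesis by simp
  qed
  have anti: "g i j = - g j i" for i j
    unfolding g_def by (subst sym) (simp add: algebra_simps)
  \<comment> \<open>A positive \<open>\<mu> i j\<close> on a line means that the line is saturated
    under \<open>\<theta>\<close>, so its flow cannot increase in passing to
    \<open>\<theta>'\<close>.\<close>
  have le: "\<mu> i j * flow G \<delta> i j \<le> 0" for i j
  proof (cases "is_line G i j")
    case True
    have "\<mu> i j * flow G \<delta> i j = \<mu> i j * (flow G \<theta>' i j - capacity G i j)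
        - \<mu> i j * (flow G \<theta> i j - capacity G i j)"
      by (simp add: \<delta>_def flow_def algebra_simps)
    also have "\<dots> \<le> 0"
      unfolding slack[OF True] using \<mu>0[of i j] y True
      by (simp add: ed_feasible_def mult_nonneg_nonpos)
    finally show ?thesis .
  next
    case False
    then have "admittance G i j = 0"
      using conn by (metis connected_power_network_def is_line_def less_eq_real_def)
    then show ?thesis by (simp add: flow_def)
  qed
  have "(\<delta> i - \<delta> j) * g i j = \<mu> i j * flow G \<delta> i j + \<mu> j i * flow G \<delta> j i" for i j
    unfolding g_def flow_def sym[of j i] by (simp add: algebra_simps)
  then have "(\<delta> i - \<delta> j) * g i j \<le> 0" for i j
    using le[of i j] le[of j i] by simp
  then have "(\<Sum>i\<in>UNIV. \<Sum>j\<in>UNIV. (\<delta> i - \<delta> j) * g i j) \<le> 0"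
    by (intro sum_nonpos) auto
  then have "(\<Sum>i\<in>UNIV. \<delta> i * (\<Sum>j\<in>UNIV. g i j)) \<le> 0"
    using sum_weighted_antisym[of g \<delta>, OF anti] by linarith
  then have "(\<Sum>i\<in>UNIV. \<pi> i * net_outflow G \<delta> i) \<ge> 0"
    unfolding net_outflow_self_adjoint[of \<pi>] \<pi>_out by (simp add: sum_negf)
  moreover have "net_outflow G \<delta> i = net_outflow G \<theta>' i - net_outflow G \<theta> i" for i
    using net_outflow_add[of G \<theta>' "-1" \<theta> i] by (simp add: \<delta>_def[abs_def])
  ultimately show ?thesis
    using sum_weighted_feasible[OF x, of \<pi>] sum_weighted_feasible[OF y, of \<pi>]
    by (simp add: right_diff_distrib sum_subtractf)
qed

end

section \<open>Marginal costs at an uncongested optimum\<close>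

text \<open>The mean value theorem makes \<open>f'\<close> monotone and then yields the tangent
  inequality on either side of \<open>x\<close>. Derivatives are taken within \<open>{0..}\<close>,
  so the boundary point 0 is included.\<close>

lemma cost_function_convex:
  assumes "cost_function f"
  shows "\<exists>f'. (\<forall>x\<ge>0. (f has_real_derivative f' x) (at x within {0..})) \<and>
    (\<forall>x\<ge>0. f' x \<ge> 0) \<and> (\<forall>x\<ge>0. \<forall>y\<ge>0. f x + f' x * (y - x) \<le> f y)"
proof -
  obtain f' f'' where d: "\<And>x. x \<ge> 0 \<Longrightarrow> (f has_real_derivative f' x) (at x within {0..})"
    and d2: "\<And>x. x \<ge> 0 \<Longrightarrow> (f' has_real_derivative f'' x) (at x within {0..})"
    and nn: "\<And>x. x \<ge> 0 \<Longrightarrow> f' x \<ge> 0" "\<And>x. x \<ge> 0 \<Longrightarrow> f'' x \<ge> 0"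
    using assms unfolding cost_function_def by blast
  have mvt: "\<exists>z\<in>{a<..<b}. g b - g a = g' z * (b - a)"
    if "0 \<le> a" "a < b" "\<And>x. x \<ge> 0 \<Longrightarrow> (g has_real_derivative g' x) (at x within {0..})"
    for a b :: real and g g' :: "real \<Rightarrow> real"
  proof (rule mvt_simple[OF \<open>a < b\<close>, where f' = "\<lambda>x h. g' x * h"])
    fix x assume "a \<le> x" "x \<le> b"
    with \<open>0 \<le> a\<close> have "(g has_real_derivative g' x) (at x within {a..b})"
      by (intro DERIV_subset[OF that(3)]) auto
    then show "(g has_derivative (\<lambda>h. g' x * h)) (at x within {a..b})"
      by (simp add: has_field_derivative_def)
  qed
  have mono: "f' a \<le> f' b" if ab: "0 \<le> a" "a < b" for a b
  proof -
    obtain z where "z \<in> {a<..<b}" "f' b - f' a = f'' z * (b - a)"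
      using mvt[OF ab d2] by blast
    moreover from this have "f'' z * (b - a) \<ge> 0"
      using nn(2)[of z] ab by simp
    ultimately show ?thesis
      by simp
  qed
  have "f x + f' x * (y - x) \<le> f y" if "x \<ge> 0" "y \<ge> 0" for x y
  proof (cases x y rule: linorder_cases)
    case less
    then obtain z where z: "z \<in> {x<..<y}" "f y - f x = f' z * (y - x)"
      using mvt[OF \<open>x \<ge> 0\<close> less d] by blast
    then have "f' x * (y - x) \<le> f' z * (y - x)"
      using mono[of x z] that by (intro mult_right_mono) auto
    with z(2) show ?thesis by linarith
  next
    case greater
    then obtain z where z: "z \<in> {y<..<x}" "f x - f y = f' z * (x - y)"
      using mvt[OF \<open>y \<ge> 0\<close> greater d] by blast
    then have "f' z * (x - y) \<le> f' x * (x - y)"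
      using mono[of z x] that by (intro mult_right_mono) auto
    with z(2) show ?thesis by (simp add: algebra_simps)
  qed simp
  then show ?thesis
    using d nn(1) by blast
qed

text \<open>
  Shifting a little production from \<open>n\<close> to \<open>m\<close> remains feasible because no line is saturated.
\<close>

lemma uncongested_optimum_marginal_costs:
  fixes G :: "('i::{finite,linorder}, 'n::finite) power_network"
  assumes conn: "connected_power_network G"
    and opt: "ed_optimal G c x \<theta>"
    and slack: "\<And>i j. is_line G i j \<Longrightarrow> flow G \<theta> i j < capacity G i j"
    and dn: "(c n has_real_derivative dn) (at (x n) within {0..})"
    and dm: "(c m has_real_derivative dm) (at (x m) within {0..})"
    and pos: "x n > 0"
  shows "dn \<le> dm"
proof (cases "m = n")
  case True
  have "at (x n) within {0..} = at (x n)"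
    using pos by (intro at_within_interior) simp
  with dn dm True show ?thesis
    using DERIV_unique by auto
next
  case False
  have feas: "ed_feasible G x \<theta>"
    using opt by (simp add: ed_optimal_def)
  \<comment> \<open>Moving one unit of production from \<open>n\<close> to \<open>m\<close> changes
    the nodal injections by \<open>v\<close>, which is zero if both share a node;
    \<open>\<delta>\<close> is a potential that carries this change.\<close>
  define v where "v i = of_bool (node_of G m = i) - (of_bool (node_of G n = i) :: real)" for i
  have "(\<Sum>i\<in>UNIV. v i) = 0"
    by (simp add: v_def of_bool_def sum_subtractf)
  then obtain \<delta> where \<delta>: "\<And>i. net_outflow G \<delta> i = v i"
    using net_outflow_surj[OF conn] by blast
  define u where "u k = of_bool (m = k) - (of_bool (n = k) :: real)" for k
  define y where "y e k = x k + e * u k" for e k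
  have y: "y e m = x m + e" "y e n = x n - e" "k \<notin> {m, n} \<Longrightarrow> y e k = x k" for e k
    using False by (auto simp: y_def u_def)
  have x0: "x k \<ge> 0" for k
    using feas by (simp add: ed_feasible_def)
  have u_sum: "(\<Sum>k | node_of G k = i. u k) = v i" for i
    by (simp add: u_def v_def of_bool_def sum_subtractf)
  have "\<forall>\<^sub>F e in at_right 0. flow G (\<lambda>i. \<theta> i + e * \<delta> i) i j \<le> capacity G i j"
    if "is_line G i j" for i j
  proof -
    have "((\<lambda>e. flow G \<theta> i j + e * flow G \<delta> i j) \<longlongrightarrow> flow G \<theta> i j + 0 * flow G \<delta> i j) (at_right 0)"
      by (intro tendsto_intros)
    then have "\<forall>\<^sub>F e in at_right 0. flow G \<theta> i j + e * flow G \<delta> i j < capacity G i j"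
      using slack[OF that] by (auto dest: order_tendstoD(2))
    then show ?thesis
      by eventually_elim (simp add: flow_add)
  qed
  then have lines: "\<forall>\<^sub>F e in at_right 0. \<forall>i j. is_line G i j \<longrightarrow>
      flow G (\<lambda>i. \<theta> i + e * \<delta> i) i j \<le> capacity G i j"
    by (intro eventually_all_finite) (auto simp: eventually_mono)
  have small: "\<forall>\<^sub>F e in at_right 0. 0 < e \<and> e < x n"
    using pos by (auto simp: eventually_at_right_field)
  \<comment> \<open>Optimality of \<open>x\<close> bounds the unit saving at \<open>n\<close> by the
    unit cost added at \<open>m\<close>; letting \<open>e\<close> tend to 0 compares the
    derivatives.\<close>
  have "\<forall>\<^sub>F e in at_right 0. ((c m (x m + e) - c m (x m)) / e) \<ge> (c n (x n) - c n (x n - e)) / e"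
    using lines small
  proof eventually_elim
    case (elim e)
    have "(\<Sum>k | node_of G k = i. y e k) = (\<Sum>k | node_of G k = i. x k) + e * v i" for i
      by (simp add: y_def sum.distrib sum_distrib_left[symmetric] u_sum)
    then have "(\<Sum>k | node_of G k = i. y e k) - demand G i
        = net_outflow G (\<lambda>i. \<theta> i + e * \<delta> i) i" for i
      by (simp add: feasible_balance[OF conn feas] net_outflow_add \<delta>)
    moreover have "y e k \<ge> 0" for k
      using y(1,2)[of e] y(3)[of k e] elim x0[of k] x0[of m] by (cases "k = m"; cases "k = n") auto
    ultimately have "ed_feasible G (y e) (\<lambda>i. \<theta> i + e * \<delta> i)"
      using elim by (simp add: ed_feasible_def net_outflow_def)
    then have "(\<Sum>k\<in>UNIV. c k (x k)) \<le> (\<Sum>k\<in>UNIV. c k (y e k))"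
      using opt unfolding ed_optimal_def by blast
    moreover have "(\<Sum>k\<in>UNIV. g k) = g m + g n + sum g (UNIV - {m, n})" for g :: "'n \<Rightarrow> real"
      using sum.subset_diff[of "{m, n}" UNIV g] False by simp
    moreover have "(\<Sum>k\<in>UNIV - {m, n}. c k (y e k)) = (\<Sum>k\<in>UNIV - {m, n}. c k (x k))"
      by (rule sum.cong) (auto simp: y)
    ultimately have "c m (x m) + c n (x n) \<le> c m (x m + e) + c n (x n - e)"
      by (simp add: y)
    then show ?case
      using elim by (intro divide_right_mono) auto
  qed
  moreover have "((\<lambda>e. (c m (x m + e) - c m (x m)) / e) \<longlongrightarrow> dm) (at_right 0)"
  proof -
    have "(c m has_real_derivative dm) (at_right (x m))"
      using x0[of m] by (intro DERIV_subset[OF dm]) auto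
    then have "((\<lambda>y. (c m y - c m (x m)) / (y - x m)) \<longlongrightarrow> dm) (at_right (x m))"
      by (simp add: has_field_derivative_iff)
    then show ?thesis
      by (simp add: filterlim_at_right_to_0[of _ _ "x m"] add.commute)
  qed
  moreover have "((\<lambda>e. (c n (x n) - c n (x n - e)) / e) \<longlongrightarrow> dn) (at_right 0)"
  proof -
    have "at (x n) within {0..} = at (x n)"
      using pos by (intro at_within_interior) simp
    then have "((\<lambda>h. (c n (x n + h) - c n (x n)) / h) \<longlongrightarrow> dn) (at 0)"
      using dn by (simp add: DERIV_def)
    then have "((\<lambda>h. (c n (x n + h) - c n (x n)) / h) \<longlongrightarrow> dn) (at_left 0)"
      by (rule filterlim_mono) (auto simp: at_le)
    then have "((\<lambda>e. (c n (x n + - e) - c n (x n)) / - e) \<longlongrightarrow> dn) (at_right 0)"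
      by (simp add: filterlim_at_left_to_right)
    then show ?thesis
      by (simp add: minus_divide_left)
  qed
  ultimately show ?thesis
    by (intro tendsto_le[of "at_right 0"]) auto
qed

text \<open>All producing generators share one marginal cost, which is taken as
  \<open>\<rho>\<close>; idle ones have marginal cost at least \<open>\<rho>\<close>. Convexity
  turns this into profit maximization.\<close>

lemma supporting_price:
  fixes G :: "('i::{finite,linorder}, 'n::finite) power_network"
  assumes conn: "connected_power_network G"
    and cost: "\<And>n. cost_function (c n)"
    and opt: "ed_optimal G c x \<theta>"
    and slack: "\<And>i j. is_line G i j \<Longrightarrow> flow G \<theta> i j < capacity G i j"
  obtains \<rho> where "\<rho> \<ge> 0" "\<And>n y. y \<ge> 0 \<Longrightarrow> \<rho> * y - c n y \<le> \<rho> * x n - c n (x n)"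
proof (cases "\<exists>n. x n > 0")
  case False
  \<comment> \<open>With no production the price 0 works: costs are nonnegative and
    \<open>c n 0 = 0\<close>.\<close>
  have "x n = 0" for n
    using opt False by (simp add: ed_optimal_def ed_feasible_def not_less order_antisym)
  then show ?thesis
    using that[of 0] cost by (simp add: cost_function_def)
next
  case True
  then obtain n0 where n0: "x n0 > 0" by blast
  have x0: "x n \<ge> 0" for n
    using opt by (simp add: ed_optimal_def ed_feasible_def)
  have "\<exists>f'. \<forall>n. (\<forall>x\<ge>0. (c n has_real_derivative f' n x) (at x within {0..})) \<and>
      (\<forall>x\<ge>0. f' n x \<ge> 0) \<and> (\<forall>x\<ge>0. \<forall>y\<ge>0. c n x + f' n x * (y - x) \<le> c n y)"
    by (rule choice) (rule allI[OF cost_function_convex[OF cost]])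
  then obtain f' where f': "\<forall>n. (\<forall>x\<ge>0. (c n has_real_derivative f' n x) (at x within {0..})) \<and>
      (\<forall>x\<ge>0. f' n x \<ge> 0) \<and> (\<forall>x\<ge>0. \<forall>y\<ge>0. c n x + f' n x * (y - x) \<le> c n y)"
    by (rule exE)
  have d: "(c n has_real_derivative f' n x) (at x within {0..})" if "x \<ge> 0" for n x
    using spec[OF f', of n] that by simp
  have nn: "f' n x \<ge> 0" if "x \<ge> 0" for n x
    using spec[OF f', of n] that by simp
  have conv: "c n x + f' n x * (y - x) \<le> c n y" if "x \<ge> 0" "y \<ge> 0" for n x y
    using spec[OF f', of n] that by simp
  have le: "f' n (x n) \<le> f' m (x m)" if "x n > 0" for n m
    using uncongested_optimum_marginal_costs[OF conn opt slack d d that] x0 by blast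
  define \<rho> where "\<rho> = f' n0 (x n0)"
  have "\<rho> * y - c n y \<le> \<rho> * x n - c n (x n)" if "y \<ge> 0" for n y
  proof -
    \<comment> \<open>Equality if \<open>n\<close> produces; otherwise \<open>x n = 0\<close>, so
      \<open>y - x n\<close> is nonnegative and the marginal cost is at least
      \<open>\<rho>\<close>.\<close>
    have "\<rho> * (y - x n) \<le> f' n (x n) * (y - x n)"
    proof (cases "x n > 0")
      case True
      then have "f' n (x n) = \<rho>"
        unfolding \<rho>_def using le n0 by (intro antisym) auto
      then show ?thesis by simp
    next
      case False
      then have "x n = 0" using x0[of n] by simp
      then show ?thesis
        using le[OF n0, of n] that by (intro mult_right_mono) (auto simp: \<rho>_def)
    qed
    then show ?thesis
      using conv[OF x0[of n] that, of n] by (simp add: algebra_simps)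
  qed
  then show ?thesis
    using that[of \<rho>] nn x0 by (simp add: \<rho>_def)
qed

section \<open>Flat bids\<close>

lemma bid_fun_flat: "bid_fun (\<rho>, 0, \<rho>) = (\<lambda>y. \<rho> * y)"
  by auto

text \<open>Uniqueness of limits along a nontrivial filter, as needed for the one-sided derivatives
  in the multiplier conditions.\<close>

lemma has_real_derivative_linear_iff:
  fixes y :: real
  assumes "at y within S \<noteq> bot"
  shows "((\<lambda>y. \<rho> * y) has_real_derivative l) (at y within S) \<longleftrightarrow> l = \<rho>"
proof
  have lin: "((\<lambda>y. \<rho> * y) has_real_derivative \<rho>) (at y within S)"
    by (auto intro!: derivative_eq_intros)
  then show "((\<lambda>y. \<rho> * y) has_real_derivative l) (at y within S)" if "l = \<rho>"
    using that by simp
  show "l = \<rho>" if "((\<lambda>y. \<rho> * y) has_real_derivative l) (at y within S)"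
    using that lin tendsto_unique[OF assms] unfolding has_field_derivative_iff by blast
qed

lemma multiplier_flat:
  assumes "\<pi> \<in> optimal_multipliers G f x \<theta>" and "f n = (\<lambda>y. \<rho> * y)"
  shows "x n > 0 \<Longrightarrow> \<pi> (node_of G n) = \<rho>" and "x n = 0 \<Longrightarrow> \<pi> (node_of G n) \<le> \<rho>"
  using assms unfolding optimal_multipliers_def
  by (force simp: has_real_derivative_linear_iff)+

text \<open>Replace \<open>x\<close> by a dispatch \<open>y\<close> that does without
  \<open>n\<close>. At the prices \<open>\<pi>\<close> this cannot lower the value of the dispatch,
  while the rivals together supply \<open>x n\<close> more, an exchange worth at most
  \<open>\<rho> * x n\<close> because total demand is fixed. So \<open>n\<close> receives at most
  \<open>\<rho> * x n\<close>.\<close>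

lemma price_le_flat_bids:
  fixes G :: "('i::{finite,linorder}, 'n::finite) power_network"
  assumes conn: "connected_power_network G"
    and x: "ed_feasible G x \<theta>" and \<pi>: "\<pi> \<in> optimal_multipliers G f x \<theta>"
    and flat: "\<And>m. m \<noteq> n \<Longrightarrow> f m = (\<lambda>y. \<rho> * y)"
    and y: "ed_feasible G y \<theta>'" "y n = 0"
    and pos: "x n > 0"
  shows "\<pi> (node_of G n) \<le> \<rho>"
proof -
  \<comment> \<open>Where a rival produces in \<open>x\<close> the price is exactly
    \<open>\<rho>\<close>; where it is idle the price is at most \<open>\<rho>\<close> and its
    output can only grow.\<close>
  have "\<pi> (node_of G m) * (y m - x m) \<le> \<rho> * (y m - x m)" if "m \<noteq> n" for m
  proof (cases "x m = 0")
    case True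
    then show ?thesis
      using multiplier_flat(2)[OF \<pi> flat[OF that]] y(1)
      by (auto simp: ed_feasible_def intro: mult_right_mono)
  next
    case False
    then have "x m > 0"
      using x by (simp add: ed_feasible_def order_less_le)
    then show ?thesis
      using multiplier_flat(1)[OF \<pi> flat[OF that]] by simp
  qed
  then have "(\<Sum>m\<in>UNIV - {n}. \<pi> (node_of G m) * (y m - x m)) \<le> (\<Sum>m\<in>UNIV - {n}. \<rho> * (y m - x m))"
    by (intro sum_mono) auto
  moreover have "(\<Sum>m\<in>UNIV. g m) = g n + sum g (UNIV - {n})" for g :: "'n \<Rightarrow> real"
    by (simp add: sum.remove)
  moreover have "(\<Sum>m\<in>UNIV. \<rho> * (y m - x m)) = 0"
    using feasible_total[OF conn x] feasible_total[OF conn y(1)]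
    by (simp add: sum_distrib_left[symmetric] sum_subtractf)
  ultimately have "\<pi> (node_of G n) * x n \<le> \<rho> * x n"
    using multiplier_variational[OF conn x y(1) \<pi>] y(2) by (smt (verit) mult_minus_right)
  then show ?thesis
    using pos by simp
qed

text \<open>Under equal linear bids the total cost is \<open>\<rho>\<close> times total demand, so
  every feasible dispatch is optimal, and zero line multipliers justify the uniform price.\<close>

lemma flat_bids_outcome:
  fixes G :: "('i::{finite,linorder}, 'n::finite) power_network"
  assumes conn: "connected_power_network G"
    and feas: "ed_feasible G x \<theta>"
    and slack: "\<And>i j. is_line G i j \<Longrightarrow> flow G \<theta> i j < capacity G i j"
  shows "outcome G (\<lambda>_. (\<rho>, 0, \<rho>)) x (\<lambda>_. \<rho>)"
proof -
  define f where "f = (\<lambda>n::'n. \<lambda>y. \<rho> * y)"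
  have der: "((\<lambda>y. \<rho> * y) has_real_derivative \<rho>) (at y within S)" for y S
    by (auto intro!: derivative_eq_intros)
  have "ed_optimal G f x \<theta>"
    using feas feasible_total[OF conn feas] feasible_total[OF conn]
    by (simp add: ed_optimal_def f_def sum_distrib_left[symmetric])
  moreover have mem: "(\<lambda>_. \<rho>) \<in> optimal_multipliers G f x \<theta>"
    unfolding optimal_multipliers_def f_def
    by (auto intro!: exI[of _ "\<lambda>_ _. 0"] exI[of _ \<rho>] der)
  moreover have "lex_smallest (optimal_multipliers G f x \<theta>) (\<lambda>_. \<rho>)"
    if lex: "lex_smallest (optimal_multipliers G f x \<theta>) \<pi>0" for \<pi>0
  proof (cases "\<exists>n. x n > 0")
    case True
    then obtain n where n: "x n > 0" by blast
    \<comment> \<open>With no saturated line the multiplier terms drop out of stationarity, so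
      \<open>\<pi>\<close> is harmonic, hence constant, and the producing generator fixes the
      constant.\<close>
    have uniq: "\<pi> = (\<lambda>_. \<rho>)" if \<pi>: "\<pi> \<in> optimal_multipliers G f x \<theta>" for \<pi>
    proof
      fix i
      from \<pi> obtain \<mu>
        where stat: "\<And>i. (\<Sum>j\<in>UNIV. admittance G i j * (\<pi> i - \<pi> j + \<mu> i j - \<mu> j i)) = 0"
          and compl: "\<And>i j. is_line G i j \<Longrightarrow> \<mu> i j * (flow G \<theta> i j - capacity G i j) = 0"
        unfolding optimal_multipliers_def by blast
      have sym: "admittance G i j = admittance G j i" and nonneg: "admittance G i j \<ge> 0" for i j
        using conn by (simp_all add: connected_power_network_def)
      \<comment> \<open>Slackness says nothing about pairs without a line, so only the product with
        the admittance can be claimed to vanish.\<close>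
      have \<mu>: "admittance G i j * \<mu> i j = 0" for i j
        using compl[of i j] slack[of i j] nonneg[of i j] by (auto simp: is_line_def order_less_le)
      have \<mu>': "admittance G i j * \<mu> j i = 0" for i j
        using \<mu>[of j i] sym[of i j] by simp
      have "admittance G i j * (\<pi> i - \<pi> j + \<mu> i j - \<mu> j i)
          = flow G \<pi> i j + admittance G i j * \<mu> i j - admittance G i j * \<mu> j i" for i j
        by (simp add: flow_def algebra_simps)
      then have "admittance G i j * (\<pi> i - \<pi> j + \<mu> i j - \<mu> j i) = flow G \<pi> i j" for i j
        using \<mu> \<mu>' by simp
      then have "net_outflow G \<pi> i = 0" for i
        using stat[of i] by (simp add: net_outflow_def)
      then have "\<pi> i = \<pi> (node_of G n)"
        by (rule harmonic_imp_constant[OF conn])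
      also have "\<dots> = \<rho>"
        using multiplier_flat(1)[OF \<pi>, of n \<rho>] n by (simp add: f_def)
      finally show "\<pi> i = \<rho>" .
    qed
    then show ?thesis
      using mem uniq unfolding lex_smallest_def by blast
  next
    case False
    \<comment> \<open>With zero production all prices can be lowered uniformly, so nothing is smallest.\<close>
    have \<pi>0: "\<pi>0 \<in> optimal_multipliers G f x \<theta>"
      using lex by (simp add: lex_smallest_def)
    have "(\<lambda>i. \<pi>0 i - 1) \<in> optimal_multipliers G f x \<theta>"
    proof -
      from \<pi>0 obtain \<mu> where \<mu>: "\<forall>i j. \<mu> i j \<ge> 0"
          "\<forall>n. x n = 0 \<longrightarrow> (\<exists>r. (f n has_real_derivative r) (at_right 0) \<and> \<pi>0 (node_of G n) \<le> r)"
          "\<forall>i. (\<Sum>j\<in>UNIV. admittance G i j * (\<pi>0 i - \<pi>0 j + \<mu> i j - \<mu> j i)) = 0"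
          "\<forall>i j. is_line G i j \<longrightarrow> \<mu> i j * (flow G \<theta> i j - capacity G i j) = 0"
        unfolding optimal_multipliers_def by blast
      have "\<exists>r. (f n has_real_derivative r) (at_right 0) \<and> \<pi>0 (node_of G n) - 1 \<le> r"
        if "x n = 0" for n
      proof -
        obtain r where "(f n has_real_derivative r) (at_right 0)" "\<pi>0 (node_of G n) \<le> r"
          using \<mu>(2) \<open>x n = 0\<close> by blast
        then show ?thesis
          by (intro exI[of _ r]) simp
      qed
      with \<mu>(1,3,4) False show ?thesis
        unfolding optimal_multipliers_def by (intro CollectI exI[of _ \<mu>]) simp
    qed
    moreover have "(\<lambda>i. \<pi>0 i - 1) \<noteq> \<pi>0"
      by (simp add: fun_eq_iff)
    ultimately have "less_fun \<pi>0 (\<lambda>i. \<pi>0 i - 1)"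
      using lex by (simp add: lex_smallest_def)
    then show ?thesis
      by (simp add: less_fun_def)
  qed
  ultimately show ?thesis
    unfolding outcome_def is_lmp_def bid_fun_flat f_def by blast
qed

section \<open>The equilibrium of flat bids at the supporting price\<close>

theorem theorem1:
  fixes G :: "('i::{finite,linorder}, 'n::finite) power_network"
    and c :: "'n \<Rightarrow> real \<Rightarrow> real"
  assumes "connected_power_network G"
    and "\<And>n. cost_function (c n)"
    and "\<And>n0. \<exists>x \<theta>. ed_feasible G x \<theta> \<and> x n0 = 0"
    and "\<exists>x \<theta>. ed_optimal G c x \<theta> \<and> (\<forall>i j. is_line G i j \<longrightarrow> flow G \<theta> i j < capacity G i j)"
  shows "\<exists>b x \<pi>. nash_equilibrium G c b x \<pi> \<and> efficient G c x"
proof -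
  obtain x \<theta> where opt: "ed_optimal G c x \<theta>"
    and slack: "\<And>i j. is_line G i j \<Longrightarrow> flow G \<theta> i j < capacity G i j"
    using assms(4) by blast
  obtain \<rho> where \<rho>: "\<rho> \<ge> 0" "\<And>n y. y \<ge> 0 \<Longrightarrow> \<rho> * y - c n y \<le> \<rho> * x n - c n (x n)"
    using supporting_price[OF assms(1,2) opt slack] by blast
  define b :: "'n \<Rightarrow> bid" where "b = (\<lambda>_. (\<rho>, 0, \<rho>))"
  have "outcome G b x (\<lambda>_. \<rho>)"
    unfolding b_def using flat_bids_outcome[OF assms(1) _ slack] opt by (simp add: ed_optimal_def)
  moreover have "payoff G c n x' \<pi>' \<le> payoff G c n x (\<lambda>_. \<rho>)"
    if "outcome G (b(n := \<beta>)) x' \<pi>'" for n \<beta> x' \<pi>'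
  proof -
    from that obtain \<theta>' where feas: "ed_feasible G x' \<theta>'"
      and \<pi>': "\<pi>' \<in> optimal_multipliers G (\<lambda>m. bid_fun ((b(n := \<beta>)) m)) x' \<theta>'"
      unfolding outcome_def ed_optimal_def is_lmp_def by blast
    obtain y \<theta>'' where y: "ed_feasible G y \<theta>''" "y n = 0"
      using assms(3) by blast
    have "x' n \<ge> 0"
      using feas by (simp add: ed_feasible_def)
    have flat: "bid_fun ((b(n := \<beta>)) m) = (\<lambda>y. \<rho> * y)" if "m \<noteq> n" for m
      using that by (simp add: b_def bid_fun_flat del: bid_fun.simps)
    \<comment> \<open>An idle deviator has no revenue at any price; a producing one faces a price of
      at most \<open>\<rho>\<close>, since the others can serve the demand by
      \<open>y\<close>.\<close>
    have "\<pi>' (node_of G n) * x' n \<le> \<rho> * x' n"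
      using price_le_flat_bids[OF assms(1) feas \<pi>' flat y] \<open>x' n \<ge> 0\<close>
      by (cases "x' n = 0") (auto intro: mult_right_mono)
    then show ?thesis
      using \<rho>(2)[OF \<open>x' n \<ge> 0\<close>, of n] by (simp add: payoff_def)
  qed
  ultimately have "nash_equilibrium G c b x (\<lambda>_. \<rho>)"
    using \<rho>(1) unfolding nash_equilibrium_def by (auto simp: b_def)
  moreover have "efficient G c x"
    using opt by (auto simp: efficient_def)
  ultimately show ?thesis
    by blast
qed

end
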